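(* Let $(X,Y,Z)$ be the solution of the forward-backward stochastic differential equation $$ \begin{aligned} dX_s &= b(X_s)\,ds+\sigma(X_s)\,dB_s, & X_0&=x,\\ dY_s &= \left(\tfrac12|Z_s|^2-f(X_s)\right)ds+Z_s\cdot dB_s, & Y_\tau&=g(X_\tau), \end{aligned} $$ on $[0,\tau]$, where $x\in O$ and $\tau=\inf\{t>0: X_t\notin O\}$. Define $$ L^Z_\tau=-\int_0^\tau Z_s\cdot dB_s-\frac12\int_0^\tau|Z_s|^2\,ds,\qquad W_\tau=\int_0^\tau f(X_s)\,ds+g(X_\tau). $$ Then, with probability one, $$ \mathbf{E}_x\left[\exp(-W_\tau)\right]=\exp\left(-L^Z_\tau-W_\tau\right), $$ or, equivalently, $$ F(x)=L^Z_\tau+W_\tau, $$ where $F(x)=Y_0$ is the free energy $F(x)=-\log\mathbf{E}_x[\exp(-W_\tau)]$.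
   Context: Setting and standing assumptions. $B=(B_s)_{s\ge0}$ is a standard $m$-dimensional Brownian motion on a probability space $(\Omega,\mathcal{E},P)$. The coefficients $b:\mathbb{R}^d\to\mathbb{R}^d$ and $\sigma:\mathbb{R}^d\to\mathbb{R}^{d\times m}$ are such that the SDE $dX_s=b(X_s)ds+\sigma(X_s)dB_s$, $X_0=x$, has a unique strong solution, and $\sigma\sigma^T$ has a uniformly bounded inverse. $O\subset\mathbb{R}^d$ is open and bounded with smooth boundary $\partial O$; the exit time $\tau$ is almost surely finite. The real-valued functions $f,g$ are bounded and sufficiently smooth. $\mathbf{E}_x$ denotes expectation over the realisations of the SDE solution $X$ with $X_0=x$. The data $b,\sigma,f,g,O$ are assumed regular enough that the following standing facts hold. The Hamilton-Jacobi-Bellman boundary value problem $$ LV-\tfrac12|\sigma^T\nabla V|^2+f=0\ \text{in } O,\qquad V=g\ \text{on }\partial O,\qquad L=\tfrac12\sigma\sigma^T:\nabla^2+b\cdot\nabla, $$ has a classical solution $V\in C^2(O)\cap C(\overline{O})$; this solution equals the free energy, $V(x)=F(x)=-\log\mathbf{E}_x[\exp(-W_\tau)]$; and the forward-backward SDE in the claim has a unique solution $(X,Y,Z)$ ($Y$ continuous and adapted, $Z$ predictable and square integrable), which is given by $Y_s=V(X_s)$ and $Z_s=\sigma(X_s)^T\nabla V(X_s)$. In particular $Y_0=V(x)$. *)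

theory Defs
  imports "HOL-Probability.Probability"
begin

section \<open>Classical differential calculus on open subsets of Euclidean space\<close>

definition partial_deriv :: "'d \<Rightarrow> (real ^ 'd::finite \<Rightarrow> real) \<Rightarrow> real ^ 'd \<Rightarrow> real" where
  "partial_deriv i h y = frechet_derivative h (at y) (axis i 1)"

definition grad :: "(real ^ 'd::finite \<Rightarrow> real) \<Rightarrow> real ^ 'd \<Rightarrow> real ^ 'd" where
  "grad h y = (\<chi> i. partial_deriv i h y)"

definition hessian :: "(real ^ 'd::finite \<Rightarrow> real) \<Rightarrow> real ^ 'd \<Rightarrow> real ^ 'd ^ 'd" where
  "hessian h y = (\<chi> i j. partial_deriv i (partial_deriv j h) y)"

text \<open>Only meant for open \<open>U\<close>, since derivatives are taken in full neighbourhoods.\<close>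

primrec C_k_on :: "nat \<Rightarrow> (real ^ 'd::finite \<Rightarrow> real) \<Rightarrow> (real ^ 'd) set \<Rightarrow> bool" where
  "C_k_on 0 h U \<longleftrightarrow> continuous_on U h"
| "C_k_on (Suc k) h U \<longleftrightarrow>
     (\<forall>y\<in>U. h differentiable (at y)) \<and> (\<forall>i. C_k_on k (partial_deriv i h) U)"

definition smooth_boundary :: "(real ^ 'd::finite) set \<Rightarrow> bool" where
  "smooth_boundary D \<longleftrightarrow>
     (\<forall>p\<in>frontier D. \<exists>U \<phi>. open U \<and> p \<in> U \<and> (\<forall>k. C_k_on k \<phi> U) \<and>
        (\<forall>y\<in>U. grad \<phi> y \<noteq> 0) \<and> D \<inter> U = {y \<in> U. \<phi> y < 0})"

section \<open>Brownian motion and its augmented filtration\<close>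

text \<open>Processes are functions of time and outcome; only times \<open>t \<ge> 0\<close> are relevant.\<close>

definition brownian_motion :: "'a measure \<Rightarrow> (real \<Rightarrow> 'a \<Rightarrow> real ^ 'm::finite) \<Rightarrow> bool" where
  "brownian_motion M B \<longleftrightarrow>
     (\<forall>t\<ge>0. B t \<in> borel_measurable M) \<and>
     (AE \<omega> in M. B 0 \<omega> = 0) \<and>
     (AE \<omega> in M. continuous_on {0..} (\<lambda>t. B t \<omega>)) \<and>
     (\<forall>n p. 0 \<le> p 0 \<and> mono (p :: nat \<Rightarrow> real) \<longrightarrow>
        prob_space.indep_vars M (\<lambda>_. borel) (\<lambda>k \<omega>. B (p (Suc k)) \<omega> - B (p k) \<omega>) {..<n}) \<and>
     (\<forall>s t. 0 \<le> s \<and> s < t \<longrightarrow>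
        distributed M lborel (\<lambda>\<omega>. B t \<omega> - B s \<omega>)
          (\<lambda>v. ennreal (\<Prod>i\<in>UNIV. normal_density 0 (sqrt (t - s)) (v $ i))))"

definition bm_filtration ::
  "'a measure \<Rightarrow> (real \<Rightarrow> 'a \<Rightarrow> real ^ 'm::finite) \<Rightarrow> real \<Rightarrow> 'a measure" where
  "bm_filtration M B t =
     sigma (space M)
       ({B s -` A \<inter> space M | s A. 0 \<le> s \<and> s \<le> t \<and> A \<in> sets borel} \<union> null_sets M)"

definition adapted_continuous ::
  "'a measure \<Rightarrow> (real \<Rightarrow> 'a \<Rightarrow> real ^ 'm::finite) \<Rightarrow>
   (real \<Rightarrow> 'a \<Rightarrow> 'b::topological_space) \<Rightarrow> bool" where
  "adapted_continuous M B X \<longleftrightarrow>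
     (\<forall>t\<ge>0. X t \<in> borel_measurable (bm_filtration M B t)) \<and>
     (\<forall>\<omega>\<in>space M. continuous_on {0..} (\<lambda>t. X t \<omega>))"

definition predictable_sigma ::
  "'a measure \<Rightarrow> (real \<Rightarrow> 'a \<Rightarrow> real ^ 'm::finite) \<Rightarrow> (real \<times> 'a) measure" where
  "predictable_sigma M B =
     sigma ({0..} \<times> space M)
       ({{0} \<times> A | A. A \<in> sets (bm_filtration M B 0)} \<union>
        {{s<..t} \<times> A | s t A. 0 \<le> s \<and> s \<le> t \<and> A \<in> sets (bm_filtration M B s)})"

definition predictable ::
  "'a measure \<Rightarrow> (real \<Rightarrow> 'a \<Rightarrow> real ^ 'm::finite) \<Rightarrow>
   (real \<Rightarrow> 'a \<Rightarrow> 'b::topological_space) \<Rightarrow> bool" where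
  "predictable M B H \<longleftrightarrow> (\<lambda>(t, \<omega>). H t \<omega>) \<in> borel_measurable (predictable_sigma M B)"

section \<open>The Ito integral\<close>

text \<open>A simple integrand is \<open>\<xi> k\<close> on \<open>(p k, p (k+1)]\<close> for \<open>k < n\<close> and \<open>0\<close> elsewhere.\<close>

definition simple_integrand_data ::
  "'a measure \<Rightarrow> (real \<Rightarrow> 'a \<Rightarrow> real ^ 'm::finite) \<Rightarrow>
   nat \<Rightarrow> (nat \<Rightarrow> real) \<Rightarrow> (nat \<Rightarrow> 'a \<Rightarrow> real ^ 'm) \<Rightarrow> bool" where
  "simple_integrand_data M B n p \<xi> \<longleftrightarrow>
     0 \<le> p 0 \<and> mono p \<and>
     (\<forall>k<n. \<xi> k \<in> borel_measurable (bm_filtration M B (p k)) \<and> bounded (\<xi> k ` space M))"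

definition simple_integrand ::
  "nat \<Rightarrow> (nat \<Rightarrow> real) \<Rightarrow> (nat \<Rightarrow> 'a \<Rightarrow> real ^ 'm::finite) \<Rightarrow> real \<Rightarrow> 'a \<Rightarrow> real ^ 'm" where
  "simple_integrand n p \<xi> t \<omega> = (\<Sum>k<n. indicator {p k<..p (Suc k)} t *\<^sub>R \<xi> k \<omega>)"

definition simple_integral ::
  "(real \<Rightarrow> 'a \<Rightarrow> real ^ 'm::finite) \<Rightarrow>
   nat \<Rightarrow> (nat \<Rightarrow> real) \<Rightarrow> (nat \<Rightarrow> 'a \<Rightarrow> real ^ 'm) \<Rightarrow> real \<Rightarrow> 'a \<Rightarrow> real" where
  "simple_integral B n p \<xi> t \<omega> =
     (\<Sum>k<n. \<xi> k \<omega> \<bullet> (B (min (p (Suc k)) t) \<omega> - B (min (p k) t) \<omega>))"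

definition ito_integrand ::
  "'a measure \<Rightarrow> (real \<Rightarrow> 'a \<Rightarrow> real ^ 'm::finite) \<Rightarrow> (real \<Rightarrow> 'a \<Rightarrow> real ^ 'm) \<Rightarrow> bool" where
  "ito_integrand M B H \<longleftrightarrow>
     predictable M B H \<and>
     (AE \<omega> in M. \<forall>T\<ge>0. (\<integral>\<^sup>+s\<in>{0..T}. ennreal ((norm (H s \<omega>))\<^sup>2) \<partial>lborel) < \<infinity>)"

text \<open>
  \<open>I\<close> is a version of the process \<open>\<integral>\<^sub>0\<^sup>t H\<^sub>s \<cdot> dB\<^sub>s\<close>: a continuous adapted process that is
  the limit in probability of integrals of simple integrands \<open>H\<^sup>j\<close> with
  \<open>\<integral>\<^sub>0\<^sup>T |H\<^sup>j\<^sub>s - H\<^sub>s|\<^sup>2 ds \<rightarrow> 0\<close> in probability for every \<open>T\<close>. For \<open>H\<close> an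
  \<^term>\<open>ito_integrand\<close> such an \<open>I\<close> exists and is unique up to indistinguishability.
\<close>

definition is_ito_integral ::
  "'a measure \<Rightarrow> (real \<Rightarrow> 'a \<Rightarrow> real ^ 'm::finite) \<Rightarrow> (real \<Rightarrow> 'a \<Rightarrow> real ^ 'm) \<Rightarrow>
   (real \<Rightarrow> 'a \<Rightarrow> real) \<Rightarrow> bool" where
  "is_ito_integral M B H I \<longleftrightarrow>
     adapted_continuous M B I \<and>
     (\<exists>n p \<xi>.
        (\<forall>j :: nat. simple_integrand_data M B (n j) (p j) (\<xi> j)) \<and>
        (\<forall>T\<ge>0. \<forall>\<epsilon>>0.
           (\<lambda>j. measure M {\<omega> \<in> space M.
                  (\<integral>\<^sup>+s\<in>{0..T}. ennreal ((norm (simple_integrand (n j) (p j) (\<xi> j) s \<omega> - H s \<omega>))\<^sup>2)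
                     \<partial>lborel) > ennreal \<epsilon>}) \<longlonglongrightarrow> 0) \<and>
        (\<forall>t\<ge>0. \<forall>\<epsilon>>0.
           (\<lambda>j. measure M {\<omega> \<in> space M.
                  \<bar>simple_integral B (n j) (p j) (\<xi> j) t \<omega> - I t \<omega>\<bar> > \<epsilon>}) \<longlonglongrightarrow> 0))"

definition ito_integral ::
  "'a measure \<Rightarrow> (real \<Rightarrow> 'a \<Rightarrow> real ^ 'm::finite) \<Rightarrow> (real \<Rightarrow> 'a \<Rightarrow> real ^ 'm) \<Rightarrow>
   real \<Rightarrow> 'a \<Rightarrow> real" where
  "ito_integral M B H = (SOME I. is_ito_integral M B H I)"

section \<open>The forward equation and the exit time\<close>

text \<open>Strong solutions: adapted to the augmented filtration of the driving Brownian motion.\<close>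

definition sde_solution ::
  "'a measure \<Rightarrow> (real \<Rightarrow> 'a \<Rightarrow> real ^ 'm::finite) \<Rightarrow>
   (real ^ 'd::finite \<Rightarrow> real ^ 'd) \<Rightarrow> (real ^ 'd \<Rightarrow> real ^ 'm ^ 'd) \<Rightarrow> real ^ 'd \<Rightarrow>
   (real \<Rightarrow> 'a \<Rightarrow> real ^ 'd) \<Rightarrow> bool" where
  "sde_solution M B b \<sigma> x X \<longleftrightarrow>
     adapted_continuous M B X \<and>
     (AE \<omega> in M. X 0 \<omega> = x) \<and>
     (AE \<omega> in M. \<forall>t\<ge>0. set_integrable lborel {0..t} (\<lambda>s. b (X s \<omega>))) \<and>
     (\<forall>i. ito_integrand M B (\<lambda>s \<omega>. \<sigma> (X s \<omega>) $ i)) \<and>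
     (AE \<omega> in M. \<forall>t\<ge>0.
        X t \<omega> = x + (LINT s:{0..t}|lborel. b (X s \<omega>))
                  + (\<chi> i. ito_integral M B (\<lambda>s \<omega>. \<sigma> (X s \<omega>) $ i) t \<omega>))"

definition unique_strong_solution ::
  "'a measure \<Rightarrow> (real \<Rightarrow> 'a \<Rightarrow> real ^ 'm::finite) \<Rightarrow>
   (real ^ 'd::finite \<Rightarrow> real ^ 'd) \<Rightarrow> (real ^ 'd \<Rightarrow> real ^ 'm ^ 'd) \<Rightarrow> real ^ 'd \<Rightarrow> bool" where
  "unique_strong_solution M B b \<sigma> x \<longleftrightarrow>
     (\<exists>X. sde_solution M B b \<sigma> x X \<and>
        (\<forall>X'. sde_solution M B b \<sigma> x X' \<longrightarrow> (AE \<omega> in M. \<forall>t\<ge>0. X' t \<omega> = X t \<omega>)))"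

definition exit_time ::
  "(real ^ 'd::finite) set \<Rightarrow> (real \<Rightarrow> 'a \<Rightarrow> real ^ 'd) \<Rightarrow> 'a \<Rightarrow> ereal" where
  "exit_time D X \<omega> = Inf (ereal ` {t. t > 0 \<and> X t \<omega> \<notin> D})"

definition stopped ::
  "('a \<Rightarrow> ereal) \<Rightarrow> (real \<Rightarrow> 'a \<Rightarrow> 'b) \<Rightarrow> real \<Rightarrow> 'a \<Rightarrow> 'b" where
  "stopped T Y t \<omega> = Y (real_of_ereal (min (ereal t) (T \<omega>))) \<omega>"

definition cut_off ::
  "('a \<Rightarrow> ereal) \<Rightarrow> (real \<Rightarrow> 'a \<Rightarrow> 'b::zero) \<Rightarrow> real \<Rightarrow> 'a \<Rightarrow> 'b" where
  "cut_off T Z s \<omega> = (if ereal s \<le> T \<omega> then Z s \<omega> else 0)"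

definition at_time :: "('a \<Rightarrow> ereal) \<Rightarrow> (real \<Rightarrow> 'a \<Rightarrow> 'b) \<Rightarrow> 'a \<Rightarrow> 'b" where
  "at_time T Y \<omega> = Y (real_of_ereal (T \<omega>)) \<omega>"

section \<open>Work, free energy and the forward-backward equation\<close>

definition work ::
  "(real ^ 'd::finite) set \<Rightarrow> (real ^ 'd \<Rightarrow> real) \<Rightarrow> (real ^ 'd \<Rightarrow> real) \<Rightarrow>
   (real \<Rightarrow> 'a \<Rightarrow> real ^ 'd) \<Rightarrow> 'a \<Rightarrow> real" where
  "work D f g X \<omega> =
     (LINT s:{0..real_of_ereal (exit_time D X \<omega>)}|lborel. f (X s \<omega>))
     + g (at_time (exit_time D X) X \<omega>)"

definition free_energy ::
  "'a measure \<Rightarrow> (real ^ 'd::finite) set \<Rightarrow> (real ^ 'd \<Rightarrow> real) \<Rightarrow> (real ^ 'd \<Rightarrow> real) \<Rightarrow>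
   (real \<Rightarrow> 'a \<Rightarrow> real ^ 'd) \<Rightarrow> real" where
  "free_energy M D f g X =
     - ln (prob_space.expectation M (\<lambda>\<omega>. exp (- work D f g X \<omega>)))"

definition log_density ::
  "'a measure \<Rightarrow> (real \<Rightarrow> 'a \<Rightarrow> real ^ 'm::finite) \<Rightarrow> ('a \<Rightarrow> ereal) \<Rightarrow>
   (real \<Rightarrow> 'a \<Rightarrow> real ^ 'm) \<Rightarrow> 'a \<Rightarrow> real" where
  "log_density M B T Z \<omega> =
     - at_time T (ito_integral M B (cut_off T Z)) \<omega>
     - 1 / 2 * (LINT s:{0..real_of_ereal (T \<omega>)}|lborel. (norm (Z s \<omega>))\<^sup>2)"

text \<open>
  The backward equation lives on \<open>[0, \<tau>]\<close> only, so measurability and continuity of \<open>Y\<close> are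
  required of the stopped process, and those of \<open>Z\<close> after setting it to \<open>0\<close> beyond \<open>\<tau>\<close>.
\<close>

definition fbsde_solution ::
  "'a measure \<Rightarrow> (real \<Rightarrow> 'a \<Rightarrow> real ^ 'm::finite) \<Rightarrow>
   (real ^ 'd::finite \<Rightarrow> real ^ 'd) \<Rightarrow> (real ^ 'd \<Rightarrow> real ^ 'm ^ 'd) \<Rightarrow>
   (real ^ 'd) set \<Rightarrow> (real ^ 'd \<Rightarrow> real) \<Rightarrow> (real ^ 'd \<Rightarrow> real) \<Rightarrow> real ^ 'd \<Rightarrow>
   (real \<Rightarrow> 'a \<Rightarrow> real ^ 'd) \<Rightarrow> (real \<Rightarrow> 'a \<Rightarrow> real) \<Rightarrow> (real \<Rightarrow> 'a \<Rightarrow> real ^ 'm) \<Rightarrow> bool" where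
  "fbsde_solution M B b \<sigma> D f g x X Y Z \<longleftrightarrow>
     (let T = exit_time D X in
        sde_solution M B b \<sigma> x X \<and>
        adapted_continuous M B (stopped T Y) \<and>
        predictable M B (cut_off T Z) \<and>
        (\<integral>\<^sup>+\<omega>. (\<integral>\<^sup>+s\<in>{0..}. ennreal ((norm (cut_off T Z s \<omega>))\<^sup>2) \<partial>lborel) \<partial>M) < \<infinity> \<and>
        (AE \<omega> in M. \<forall>t\<ge>0. ereal t \<le> T \<omega> \<longrightarrow>
           set_integrable lborel {0..t} (\<lambda>s. 1 / 2 * (norm (Z s \<omega>))\<^sup>2 - f (X s \<omega>)) \<and>
           Y t \<omega> = Y 0 \<omega>
             + (LINT s:{0..t}|lborel. 1 / 2 * (norm (Z s \<omega>))\<^sup>2 - f (X s \<omega>))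
             + ito_integral M B (cut_off T Z) t \<omega>) \<and>
        (AE \<omega> in M. at_time T Y \<omega> = g (at_time T X \<omega>)))"

section \<open>The Hamilton-Jacobi-Bellman boundary value problem\<close>

definition generator ::
  "(real ^ 'd::finite \<Rightarrow> real ^ 'd) \<Rightarrow> (real ^ 'd \<Rightarrow> real ^ 'm::finite ^ 'd) \<Rightarrow>
   (real ^ 'd \<Rightarrow> real) \<Rightarrow> real ^ 'd \<Rightarrow> real" where
  "generator b \<sigma> h y =
     1 / 2 * (\<Sum>i\<in>UNIV. \<Sum>j\<in>UNIV. (\<sigma> y ** transpose (\<sigma> y)) $ i $ j * hessian h y $ i $ j)
     + b y \<bullet> grad h y"

definition hjb_solution ::
  "(real ^ 'd::finite \<Rightarrow> real ^ 'd) \<Rightarrow> (real ^ 'd \<Rightarrow> real ^ 'm::finite ^ 'd) \<Rightarrow>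
   (real ^ 'd) set \<Rightarrow> (real ^ 'd \<Rightarrow> real) \<Rightarrow> (real ^ 'd \<Rightarrow> real) \<Rightarrow> (real ^ 'd \<Rightarrow> real) \<Rightarrow> bool" where
  "hjb_solution b \<sigma> D f g V \<longleftrightarrow>
     C_k_on 2 V D \<and> continuous_on (closure D) V \<and>
     (\<forall>y\<in>D. generator b \<sigma> V y - 1 / 2 * (norm (transpose (\<sigma> y) *v grad V y))\<^sup>2 + f y = 0) \<and>
     (\<forall>y\<in>frontier D. V y = g y)"

end

(* Evaluate the backward equation at the exit time. The terminal condition Y_tau = g(X_tau) turns
   it into Y_0 = L + W, so L + W is almost surely the constant Y_0 = V(x) = F(x). *)

theory Submission
  imports Defs
begin

text \<open>At the exit time the backward equation is a pathwise identity between \<open>g\<close>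
  at the exit point, \<open>Y 0\<close>, the integral of half of |Z|^2 minus \<open>f\<close>, and
  the Ito integral of \<open>Z\<close>. Solved for \<open>Y 0\<close> it reads \<open>Y 0\<close> =
  L + W. The Ito integral is the same process in the equation and in \<open>log_density\<close>, so
  it only changes sides. At time 0 the path sits at the deterministic point \<open>x\<close>, and
  \<open>Y 0\<close> = V(x) = F(x). Hence the random sum L + W is almost surely constant: exp(L) is
  exp(-W) divided by its mean.\<close>

lemma C_k_on_imp_continuous_on:
  assumes "C_k_on k h U"
  shows "continuous_on U h"
proof (cases k)
  case 0
  then show ?thesis using assms by simp
next
  case (Suc n)
  then show ?thesis
    using assms by (auto intro!: differentiable_imp_continuous_on differentiable_at_imp_differentiable_on)
qed

lemma exit_time_nonneg: "0 \<le> exit_time D X \<omega>"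
  unfolding exit_time_def by (rule Inf_greatest) auto

text \<open>Lets \<open>ln\<close> be undone in \<open>free_energy\<close>. Integrability matters:
  the integral of a non-integrable function is 0 by convention.\<close>

lemma (in prob_space) expectation_exp_pos:
  fixes h :: "'a \<Rightarrow> real"
  assumes "integrable M (\<lambda>\<omega>. exp (h \<omega>))"
  shows "0 < expectation (\<lambda>\<omega>. exp (h \<omega>))"
  using assms by (rule expectation_greater) simp

theorem mainTheorem1:
  fixes M :: "'a measure"
    and B :: "real \<Rightarrow> 'a \<Rightarrow> real ^ 'm::finite"
    and b :: "real ^ 'd::finite \<Rightarrow> real ^ 'd"
    and \<sigma> :: "real ^ 'd \<Rightarrow> real ^ 'm ^ 'd"
    and D :: "(real ^ 'd) set"
    and f g V :: "real ^ 'd \<Rightarrow> real"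
    and x :: "real ^ 'd"
    and X :: "real \<Rightarrow> 'a \<Rightarrow> real ^ 'd"
    and Y :: "real \<Rightarrow> 'a \<Rightarrow> real"
    and Z :: "real \<Rightarrow> 'a \<Rightarrow> real ^ 'm"
    and k :: nat
  assumes "prob_space M"
    and "brownian_motion M B"
    and "\<And>y. unique_strong_solution M B b \<sigma> y"
    and "\<exists>C. \<forall>y. invertible (\<sigma> y ** transpose (\<sigma> y)) \<and>
                 norm (matrix_inv (\<sigma> y ** transpose (\<sigma> y))) \<le> C"
    and "open D" and "bounded D" and "smooth_boundary D"
    and "bounded (range f)" and "bounded (range g)"
    and "C_k_on k f UNIV" and "C_k_on k g UNIV"
    and exit_finite:
      "\<And>y X'. y \<in> D \<Longrightarrow> sde_solution M B b \<sigma> y X' \<Longrightarrow> AE \<omega> in M. exit_time D X' \<omega> < \<infinity>"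
    and hjb: "hjb_solution b \<sigma> D f g V"
    and value_is_free_energy:
      "\<And>y X'. y \<in> D \<Longrightarrow> sde_solution M B b \<sigma> y X' \<Longrightarrow>
         integrable M (\<lambda>\<omega>. exp (- work D f g X' \<omega>)) \<and> V y = free_energy M D f g X'"
    and "x \<in> D"
    and fbsde: "fbsde_solution M B b \<sigma> D f g x X Y Z"
    and Y_is_V: "AE \<omega> in M. \<forall>s\<ge>0. ereal s \<le> exit_time D X \<omega> \<longrightarrow> Y s \<omega> = V (X s \<omega>)"
    and Z_is_grad_V:
      "AE \<omega> in M. AE s in lborel. 0 \<le> s \<and> ereal s < exit_time D X \<omega> \<longrightarrow>
         Z s \<omega> = transpose (\<sigma> (X s \<omega>)) *v grad V (X s \<omega>)"
  shows "(AE \<omega> in M.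
            prob_space.expectation M (\<lambda>\<omega>'. exp (- work D f g X \<omega>'))
              = exp (- log_density M B (exit_time D X) Z \<omega> - work D f g X \<omega>))
       \<and> (AE \<omega> in M.
            free_energy M D f g X = log_density M B (exit_time D X) Z \<omega> + work D f g X \<omega>)
       \<and> (AE \<omega> in M. Y 0 \<omega> = free_energy M D f g X)"
proof -
  interpret prob_space M by fact
  define T where "T = exit_time D X"
  define I where "I = ito_integral M B (cut_off T Z)"
  define W where "W = work D f g X"
  have sde: "sde_solution M B b \<sigma> x X"
    and eqn: "AE \<omega> in M. \<forall>t\<ge>0. ereal t \<le> T \<omega> \<longrightarrow>
           set_integrable lborel {0..t} (\<lambda>s. 1 / 2 * (norm (Z s \<omega>))\<^sup>2 - f (X s \<omega>)) \<and>
           Y t \<omega> = Y 0 \<omega>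
             + (LINT s:{0..t}|lborel. 1 / 2 * (norm (Z s \<omega>))\<^sup>2 - f (X s \<omega>)) + I t \<omega>"
    and terminal: "AE \<omega> in M. at_time T Y \<omega> = g (at_time T X \<omega>)"
    using fbsde by (simp_all add: fbsde_solution_def Let_def T_def I_def)
  have X_cont: "continuous_on {0..} (\<lambda>t. X t \<omega>)" if "\<omega> \<in> space M" for \<omega>
    using sde that by (simp add: sde_solution_def adapted_continuous_def)
  have X_init: "AE \<omega> in M. X 0 \<omega> = x"
    using sde by (simp add: sde_solution_def)
  have f_cont: "continuous_on UNIV f"
    using \<open>C_k_on k f UNIV\<close> by (rule C_k_on_imp_continuous_on)
  have int: "integrable M (\<lambda>\<omega>. exp (- W \<omega>))" and V_x: "V x = free_energy M D f g X"
    using value_is_free_energy[OF \<open>x \<in> D\<close> sde] by (simp_all add: W_def)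
  have exp_free: "exp (- free_energy M D f g X) = expectation (\<lambda>\<omega>. exp (- W \<omega>))"
    using expectation_exp_pos[OF int] by (simp add: free_energy_def W_def)
  \<comment> \<open>Time 0 never exceeds the exit time, so the representation Y = V(X) applies
    there.\<close>
  have Y_init: "AE \<omega> in M. Y 0 \<omega> = free_energy M D f g X"
    using Y_is_V X_init by eventually_elim (simp add: V_x exit_time_nonneg flip: zero_ereal_def)
  have main: "AE \<omega> in M. free_energy M D f g X = log_density M B T Z \<omega> + W \<omega>"
    \<comment> \<open>Off a null set the argument is pathwise; \<open>AE_space\<close> is included
      because \<open>X_cont\<close> speaks of points of \<open>space M\<close>.\<close>
    using eqn terminal Y_init exit_finite[OF \<open>x \<in> D\<close> sde] AE_space
  proof eventually_elim
    case (elim \<omega>)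
    define \<tau> where "\<tau> = real_of_ereal (T \<omega>)"
    \<comment> \<open>\<open>real_of_ereal\<close> maps infinity to 0, so finiteness of the exit
      time is what makes \<tau> the true exit time.\<close>
    have \<tau>: "ereal \<tau> = T \<omega>" "0 \<le> \<tau>"
      using elim(4) exit_time_nonneg[of D X \<omega>]
      by (auto simp: \<tau>_def T_def ereal_real real_of_ereal_pos)
    \<comment> \<open>The equation holds on the closed interval, so t = \<tau> is allowed.\<close>
    have diff: "set_integrable lborel {0..\<tau>} (\<lambda>s. 1 / 2 * (norm (Z s \<omega>))\<^sup>2 - f (X s \<omega>))"
      and Y_\<tau>: "Y \<tau> \<omega> = Y 0 \<omega>
             + (LINT s:{0..\<tau>}|lborel. 1 / 2 * (norm (Z s \<omega>))\<^sup>2 - f (X s \<omega>)) + I \<tau> \<omega>"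
      using elim(1) \<tau> by auto
    \<comment> \<open>The backward equation gives integrability of the whole drift only; splitting it into its
      two terms, as \<open>log_density\<close> and \<open>work\<close> require, uses continuity of the running cost along the path.\<close>
    have "continuous_on {0..\<tau>} (\<lambda>s. f (X s \<omega>))"
      by (rule continuous_on_compose2[OF f_cont continuous_on_subset[OF X_cont]]) (use elim in auto)
    then have f_int: "set_integrable lborel {0..\<tau>} (\<lambda>s. f (X s \<omega>))"
      by (rule borel_integrable_atLeastAtMost')
    have "(\<lambda>s. 1 / 2 * (norm (Z s \<omega>))\<^sup>2)
        = (\<lambda>s. (1 / 2 * (norm (Z s \<omega>))\<^sup>2 - f (X s \<omega>)) + f (X s \<omega>))"
      by simp
    then have Z_int: "set_integrable lborel {0..\<tau>} (\<lambda>s. 1 / 2 * (norm (Z s \<omega>))\<^sup>2)"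
      using set_integral_add(1)[OF diff f_int] by simp
    have "Y \<tau> \<omega> = Y 0 \<omega> + 1 / 2 * (LINT s:{0..\<tau>}|lborel. (norm (Z s \<omega>))\<^sup>2)
                      - (LINT s:{0..\<tau>}|lborel. f (X s \<omega>)) + I \<tau> \<omega>"
      using Y_\<tau> set_integral_diff(2)[OF Z_int f_int]
      by (simp only: set_integral_mult_right)
    moreover have "Y \<tau> \<omega> = g (X \<tau> \<omega>)"
      using elim(2) by (simp add: at_time_def \<tau>_def)
    \<comment> \<open>Solving for \<open>Y 0\<close>, the two \<open>Z\<close> terms change sign and
      form \<open>log_density\<close>; the integral of \<open>f\<close> and the terminal value form
      \<open>W\<close>.\<close>
    ultimately show ?case
      using elim(3)
      by (simp add: log_density_def work_def at_time_def W_def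
          I_def[symmetric] \<tau>_def[symmetric] T_def[symmetric])
  qed
  have "AE \<omega> in M. expectation (\<lambda>\<omega>'. exp (- W \<omega>')) = exp (- log_density M B T Z \<omega> - W \<omega>)"
    using main by eventually_elim (simp flip: exp_free)
  with main Y_init show ?thesis
    by (simp add: T_def W_def)
qed

end
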